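(* Let $c,r_0,r_1,z_0\in\mathbb{R}$ be such that $c\neq 0$ and $$0<r_0\leq r_1\leq r_0+\frac{2c^2}{r_0^2}.$$ Then there exists a non-constant solution $(\{r_n\}_{n\in\mathbb{Z}},\{z_n\}_{n\in\mathbb{Z}})$ of real sequences (with the given values $r_0,r_1,z_0$) to the system $$2(z_n-z_{n-1})^2 = r_{n+1}+r_{n-1}-2r_{n},\qquad r_n(z_n-z_{n-1}) = r_{n+1}(z_{n+1}-z_n)\qquad (n\in\mathbb{Z})$$ such that $$r_{n+1}\geq r_{n}>0\ \text{ for } n\geq 0,\qquad r_{n-1}\geq r_{n}>0\ \text{ for } n\leq 0.$$ The solution is given recursively by $$r_{n} = 2r_{n-1}-r_{n-2}+\frac{2c^2}{r_{n-1}^2}\quad\text{for } n\geq 2,\qquad r_{n} = 2r_{n+1}-r_{n+2}+\frac{2c^2}{r_{n+1}^2}\quad\text{for } n\leq -1,$$ $$z_{n} = z_{n-1}+\frac{c}{r_n}\quad\text{for } n\geq 1,\qquad z_{n} = z_{n+1}-\frac{c}{r_{n+1}}\quad\text{for } n\leq -1.$$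
   Context: A solution $(\{r_n\}_{n\in\mathbb{Z}},\{z_n\}_{n\in\mathbb{Z}})$ is called constant if both sequences $\{r_n\}$ and $\{z_n\}$ are constant in $n$, and non-constant otherwise. *)

theory Defs
  imports Complex_Main
begin

definition is_solution :: "(int \<Rightarrow> real) \<Rightarrow> (int \<Rightarrow> real) \<Rightarrow> bool" where
  "is_solution r z \<longleftrightarrow>
     (\<forall>n. 2 * (z n - z (n - 1))\<^sup>2 = r (n + 1) + r (n - 1) - 2 * r n \<and>
          r n * (z n - z (n - 1)) = r (n + 1) * (z (n + 1) - z n))"

definition constant_pair :: "(int \<Rightarrow> real) \<Rightarrow> (int \<Rightarrow> real) \<Rightarrow> bool" where
  "constant_pair r z \<longleftrightarrow> (\<forall>m n. r m = r n) \<and> (\<forall>m n. z m = z n)"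

end

(* Eliminating z: with z_n - z_{n-1} = c / r_n the second equation says that both sides equal c, and
   the first becomes r_{n+1} - 2 r_n + r_{n-1} = 2 c^2 / r_n^2.  This recursion is symmetric under
   reversal of n and keeps a positive nondecreasing sequence increasing; the upper bound on r_1 says
   exactly that r_{-1} \<ge> r_0, so it can be run from r_0 in both directions. *)
theory Submission
  imports Defs
begin

text \<open>Indexing by \<open>nat\<close> makes the second-order recursion well founded; the same
  function serves both directions.\<close>

fun ray :: "real \<Rightarrow> real \<Rightarrow> real \<Rightarrow> nat \<Rightarrow> real" where
  "ray c a b 0 = a"
| "ray c a b (Suc 0) = b"
| "ray c a b (Suc (Suc n)) = 2 * ray c a b (Suc n) - ray c a b n + 2 * c\<^sup>2 / (ray c a b (Suc n))\<^sup>2"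

text \<open>Each increment is the previous one plus a nonnegative term, so increments stay
  nonnegative and positivity propagates from \<open>a\<close>.\<close>

lemma ray_pos_mono:
  assumes "0 < a" "a \<le> b"
  shows "0 < ray c a b n \<and> ray c a b n \<le> ray c a b (Suc n)"
proof (induction n)
  case 0
  then show ?case using assms by simp
next
  case (Suc n)
  moreover have "0 \<le> 2 * c\<^sup>2 / (ray c a b (Suc n))\<^sup>2" by simp
  ultimately show ?case
    unfolding ray.simps by linarith
qed

text \<open>The second value of the backward ray is the term at -1 that the recurrence centred at 0
  forces.\<close>

definition two_sided :: "real \<Rightarrow> real \<Rightarrow> real \<Rightarrow> int \<Rightarrow> real" where
  "two_sided c a b n =
     (if 0 \<le> n then ray c a b (nat n)
      else ray c a (2 * a - b + 2 * c\<^sup>2 / a\<^sup>2) (nat (- n)))"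

lemma two_sided_nonneg: "two_sided c a b (int n) = ray c a b n"
  by (simp add: two_sided_def)

text \<open>Both rays start at \<open>a\<close>, so the backward description also covers index 0;
  the recurrence centred at -1 relies on this overlap.\<close>

lemma two_sided_nonpos:
  "two_sided c a b (- int n) = ray c a (2 * a - b + 2 * c\<^sup>2 / a\<^sup>2) n"
  by (cases n) (auto simp: two_sided_def nat_add_distrib)

lemma two_sided_recurrence:
  "two_sided c a b (n + 1) + two_sided c a b (n - 1) - 2 * two_sided c a b n
     = 2 * c\<^sup>2 / (two_sided c a b n)\<^sup>2"
proof -
  consider "n = 0" | m where "n = int (Suc m)" | m where "n = - int (Suc m)"
    by (metis int_cases2 of_nat_0 minus_zero not0_implies_Suc)
  then show ?thesis
  proof cases
    case 1
    then show ?thesis by (simp add: two_sided_def)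
  next
    case 2
    then have "n + 1 = int (Suc (Suc m))" "n - 1 = int m" by simp_all
    then show ?thesis unfolding 2 by (simp only: two_sided_nonneg ray.simps)
  next
    case 3
    \<comment> \<open>Along the backward ray the two neighbours of \<open>n\<close> swap roles,
      which leaves their sum unchanged.\<close>
    then have "n + 1 = - int m" "n - 1 = - int (Suc (Suc m))" by simp_all
    then show ?thesis unfolding 3 by (simp only: two_sided_nonpos ray.simps)
  qed
qed

lemma two_sided_mono:
  assumes "0 < a" "a \<le> b" "b \<le> a + 2 * c\<^sup>2 / a\<^sup>2"
  shows "0 \<le> n \<Longrightarrow> 0 < two_sided c a b n \<and> two_sided c a b n \<le> two_sided c a b (n + 1)"
    and "n \<le> 0 \<Longrightarrow> 0 < two_sided c a b n \<and> two_sided c a b n \<le> two_sided c a b (n - 1)"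
proof -
  assume "0 \<le> n"
  then obtain m where "n = int m" "n + 1 = int (Suc m)"
    by (metis nonneg_int_cases of_nat_Suc add.commute)
  then show "0 < two_sided c a b n \<and> two_sided c a b n \<le> two_sided c a b (n + 1)"
    using ray_pos_mono[OF assms(1,2), of c m] by (simp only: two_sided_nonneg simp_thms)
next
  assume "n \<le> 0"
  then obtain m where m: "n = - int m" by (rule nonpos_int_cases)
  then have "n - 1 = - int (Suc m)" by simp
  \<comment> \<open>The upper bound on \<open>b\<close> becomes the ordering of starting values that
    \<open>ray_pos_mono\<close> requires of the backward ray.\<close>
  moreover have "a \<le> 2 * a - b + 2 * c\<^sup>2 / a\<^sup>2" using assms(3) by linarith
  ultimately show "0 < two_sided c a b n \<and> two_sided c a b n \<le> two_sided c a b (n - 1)"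
    using ray_pos_mono[OF assms(1), of _ c m] m by (simp only: two_sided_nonpos simp_thms)
qed

text \<open>Used to recover z from its prescribed differences \<open>c / r n\<close> and its value
  at 0.\<close>

lemma ex_int_antidifference:
  fixes f :: "int \<Rightarrow> 'a::ab_group_add"
  shows "\<exists>g. g 0 = g0 \<and> (\<forall>n. g n - g (n - 1) = f n)"
proof -
  \<comment> \<open>At most one of the two intervals is nonempty: the first for positive
    \<open>n\<close>, the second for negative \<open>n\<close>. Both are empty at 0.\<close>
  define g where "g n = g0 + (\<Sum>k\<in>{1..n}. f k) - (\<Sum>k\<in>{n+1..0}. f k)" for n :: int
  have "g n - g (n - 1) = f n" for n
  proof (cases "1 \<le> n")
    case True
    then have "{1..n} = insert n {1..n-1}" by auto
    with True show ?thesis by (simp add: g_def)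
  next
    case False
    then have "{n..0} = insert n {n+1..0}" by auto
    with False show ?thesis by (simp add: g_def)
  qed
  then show ?thesis by (intro exI[of _ g]) (simp add: g_def)
qed

theorem proposition2p1:
  fixes c r0 r1 z0 :: real
  assumes "c \<noteq> 0"
    and "0 < r0"
    and "r0 \<le> r1"
    and "r1 \<le> r0 + 2 * c\<^sup>2 / r0\<^sup>2"
  shows "\<exists>(r :: int \<Rightarrow> real) (z :: int \<Rightarrow> real).
    r 0 = r0 \<and> r 1 = r1 \<and> z 0 = z0 \<and>
    is_solution r z \<and> \<not> constant_pair r z \<and>
    (\<forall>n\<ge>0. r (n + 1) \<ge> r n \<and> r n > 0) \<and>
    (\<forall>n\<le>0. r (n - 1) \<ge> r n \<and> r n > 0) \<and>
    (\<forall>n\<ge>2. r n = 2 * r (n - 1) - r (n - 2) + 2 * c\<^sup>2 / (r (n - 1))\<^sup>2) \<and>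
    (\<forall>n\<le>-1. r n = 2 * r (n + 1) - r (n + 2) + 2 * c\<^sup>2 / (r (n + 1))\<^sup>2) \<and>
    (\<forall>n\<ge>1. z n = z (n - 1) + c / r n) \<and>
    (\<forall>n\<le>-1. z n = z (n + 1) - c / r (n + 1))"
proof -
  define r where "r = two_sided c r0 r1"
  obtain z where z0: "z 0 = z0" and z: "\<And>n. z n - z (n - 1) = c / r n"
    using ex_int_antidifference[of z0 "\<lambda>n. c / r n"] by blast
  have up: "0 < r n \<and> r n \<le> r (n + 1)" if "0 \<le> n" for n
    unfolding r_def using two_sided_mono(1)[OF assms(2-4) that] .
  have down: "0 < r n \<and> r n \<le> r (n - 1)" if "n \<le> 0" for n
    unfolding r_def using two_sided_mono(2)[OF assms(2-4) that] .
  have pos: "0 < r n" for n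
    using up down by (meson linear)
  have rec: "r (n + 1) + r (n - 1) - 2 * r n = 2 * c\<^sup>2 / (r n)\<^sup>2" for n
    unfolding r_def by (rule two_sided_recurrence)
  have z': "z (n + 1) - z n = c / r (n + 1)" for n
    using z[of "n + 1"] by simp
  \<comment> \<open>After rewriting, the first equation compares the square of
    \<open>c / r n\<close> with its expanded form, and both sides of the second reduce to
    \<open>c\<close>; each cancellation uses \<open>r n\<close> nonzero.\<close>
  have "is_solution r z"
    unfolding is_solution_def z z' rec
    using pos by (simp add: power_divide less_imp_neq[THEN not_sym])
  moreover have "\<not> constant_pair r z"
  proof
    assume "constant_pair r z"
    then have "z 1 = z 0" by (simp add: constant_pair_def)
    \<comment> \<open>The difference of z between 0 and 1 is \<open>c / r 1\<close>, which is
      nonzero.\<close>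
    then show False using z[of 1] pos[of 1] \<open>c \<noteq> 0\<close> by simp
  qed
  moreover have "r 0 = r0" "r 1 = r1" by (simp_all add: r_def two_sided_def)
  \<comment> \<open>The recurrence centred at \<open>n - 1\<close> is solved for its upper
    neighbour; next, the one centred at \<open>n + 1\<close> for its lower neighbour.\<close>
  moreover have "r n = 2 * r (n - 1) - r (n - 2) + 2 * c\<^sup>2 / (r (n - 1))\<^sup>2" for n
    using rec[of "n - 1"] by simp
  moreover have "r n = 2 * r (n + 1) - r (n + 2) + 2 * c\<^sup>2 / (r (n + 1))\<^sup>2" for n
    using rec[of "n + 1"] by (simp add: add.assoc)
  moreover have "z n = z (n - 1) + c / r n" for n
    using z[of n] by (simp add: algebra_simps)
  moreover have "z n = z (n + 1) - c / r (n + 1)" for n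
    using z'[of n] by (simp add: algebra_simps)
  ultimately show ?thesis
    using z0 up down by (intro exI[of _ r] exI[of _ z]) blast
qed

end
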